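(* Let $(G,u,c,B)$ be an instance of (BMFNI) on a two-terminal series-parallel graph $G$ with decomposition tree $T_G$. Define label sets $L(H,x)\subseteq\mathbb{N}^2$ for all graphs $H$ in $T_G$ and all $x\in\{0,1,\dots,B\}$ recursively as follows. (1) If $H$ is primitive with single arc $a^*$, then $L(H,x)=\{(u^1(a^* ),u^2(a^* ))\}$ if $x<c(a^* )$, and $L(H,x)=\{(0,0)\}$ if $x\geq c(a^* )$. (2) If $H$ is the parallel composition of $H_1$ and $H_2$, then $L(H,x)=\min\big\{\bigcup_{k=0}^x L(H_1,k)\oplus L(H_2,x-k)\big\}$. (3) If $H$ is the series composition of $H_1$ and $H_2$, then $L(H,x)=\min\big\{\bigcup_{k=0}^x L(H_1,k)\odot L(H_2,x-k)\big\}$. Then, after termination of the dynamic programming algorithm that computes these sets bottom-up along $T_G$, the label set $L(G,B)$ is the set of non-dominated points of the (BMFNI) instance $(G,u,c,B)$.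
   Context: $\mathbb{N}$ includes $0$. Graphs are directed and parallel arcs are allowed. An instance $(G,u,c,B)$ of the biobjective maximum flow network interdiction problem (BMFNI) consists of a directed graph $G=(V,A)$ with $m=|A|$ arcs, a source $s\in V$ and a sink $t\in V$, $s\neq t$, two arc capacity functions $u=(u^1,u^2)\colon A\to\mathbb{N}^2$, interdiction costs $c(a)\in\mathbb{N}$ for $a\in A$, and an interdiction budget $B\in\mathbb{N}$. The set of feasible interdiction strategies is $\Gamma=\{\gamma=(\gamma_a)_{a\in A}\in\{0,1\}^m \mid \sum_{a\in A}c(a)\gamma_a\leq B\}$. For $\gamma\in\Gamma$, let $A(\gamma)=\{a\in A\mid\gamma_a=1\}$ be the set of interdicted arcs and $G(\gamma)=(V,A\setminus A(\gamma))$ the interdicted graph. For a capacity function $w$, $\mathrm{VAL}(G(\gamma),w)$ is the maximum value of an $s$-$t$-flow in $G(\gamma)$ with respect to the capacities $w$, and $\mathrm{VAL}(G(\gamma),u)=(\mathrm{VAL}(G(\gamma),u^1),\mathrm{VAL}(G(\gamma),u^2))$. For $y,z\in\mathbb{N}^2$, $y\leq z$ means $y_k\leq z_k$ for $k=1,2$ and $y\neq z$. A strategy $\gamma\in\Gamma$ is efficient if there is no $\gamma'\in\Gamma$ with $\mathrm{VAL}(G(\gamma'),u)\leq\mathrm{VAL}(G(\gamma),u)$; in this case $\mathrm{VAL}(G(\gamma),u)$ is called a non-dominated point. For a finite set $S\subset\mathbb{N}^2$, $\min S$ denotes the set of all $z\in S$ for which there is no $y\in S$ with $y\leq z$. For $R,S\subset\mathbb{R}^2$: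 $R\oplus S=\{r+s\mid r\in R,s\in S\}$ (Minkowski sum), and $R\odot S=\{r\odot s\mid r\in R,s\in S\}$ with $r\odot s=(\min\{r^1,s^1\},\min\{r^2,s^2\})$ for $r=(r^1,r^2)$, $s=(s^1,s^2)$. A directed graph with source $s$ and sink $t$ is two-terminal series-parallel if it can be built by the following operations: (i) the primitive graph with vertices $s,t$ and single arc $(s,t)$; (ii) parallel composition of two such graphs $G_1$ (source $s_1$, sink $t_1$) and $G_2$ (source $s_2$, sink $t_2$), identifying $s=s_1=s_2$ and $t=t_1=t_2$; (iii) series composition, identifying $s=s_1$, $t_1=s_2$, $t=t_2$. The decomposition tree $T_G$ is the binary tree recording such a construction of $G$: each vertex of $T_G$ corresponds to a two-terminal series-parallel subgraph $H$ of $G$, leaves correspond to primitive graphs (one per arc), each inner vertex is the series or parallel composition of its two children, and the root is $G$. "$H$ in $T_G$" means $H$ is the graph of some vertex of $T_G$. *)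

theory Defs
  imports
    Complex_Main
    "HOL-Library.FuncSet"
    "HOL-Library.Set_Algebras"
    "HOL-Library.Product_Plus"
    "Graph_Theory.Digraph_Component"
begin

section \<open>Flows\<close>

text \<open>
  Graphs are finite directed multigraphs in the sense of \<^locale>\<open>fin_digraph\<close>: arcs are abstract
  objects with a tail and a head, so that parallel arcs are allowed.
\<close>

locale st_digraph = fin_digraph G for G :: "('v, 'e) pre_digraph" +
  fixes s t :: 'v
  assumes source_in_verts: "s \<in> verts G"
    and sink_in_verts: "t \<in> verts G"
    and source_neq_sink: "s \<noteq> t"

definition is_flow ::
  "('v, 'e) pre_digraph \<Rightarrow> 'v \<Rightarrow> 'v \<Rightarrow> ('e \<Rightarrow> nat) \<Rightarrow> ('e \<Rightarrow> real) \<Rightarrow> bool" where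
  "is_flow G s t w f \<longleftrightarrow>
     (\<forall>a \<in> arcs G. 0 \<le> f a \<and> f a \<le> real (w a)) \<and>
     (\<forall>v \<in> verts G - {s, t}. (\<Sum>a \<in> in_arcs G v. f a) = (\<Sum>a \<in> out_arcs G v. f a))"

definition flow_value :: "('v, 'e) pre_digraph \<Rightarrow> 'v \<Rightarrow> ('e \<Rightarrow> real) \<Rightarrow> real" where
  "flow_value G s f = (\<Sum>a \<in> out_arcs G s. f a) - (\<Sum>a \<in> in_arcs G s. f a)"

definition max_flow_value :: "('v, 'e) pre_digraph \<Rightarrow> 'v \<Rightarrow> 'v \<Rightarrow> ('e \<Rightarrow> nat) \<Rightarrow> real" where
  "max_flow_value G s t w = (GREATEST r. \<exists>f. is_flow G s t w f \<and> r = flow_value G s f)"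


section \<open>Dominance\<close>

text \<open>
  The componentwise order with equality excluded. It is stated for an arbitrary ordered component
  type because labels are pairs of naturals, whereas flow values are real numbers.
\<close>

definition pt_dominates :: "'n::order \<times> 'n \<Rightarrow> 'n \<times> 'n \<Rightarrow> bool" (infix "\<prec>" 50) where
  "y \<prec> z \<longleftrightarrow> fst y \<le> fst z \<and> snd y \<le> snd z \<and> y \<noteq> z"

definition minimal_points :: "('n::order \<times> 'n) set \<Rightarrow> ('n \<times> 'n) set" where
  "minimal_points S = {z \<in> S. \<not> (\<exists>y \<in> S. y \<prec> z)}"


section \<open>Biobjective maximum flow network interdiction\<close>

definition strategies :: "('v, 'e) pre_digraph \<Rightarrow> ('e \<Rightarrow> nat) \<Rightarrow> nat \<Rightarrow> ('e \<Rightarrow> nat) set" where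
  "strategies G c B = {\<gamma> \<in> arcs G \<rightarrow>\<^sub>E {0, 1}. (\<Sum>a \<in> arcs G. c a * \<gamma> a) \<le> B}"

definition interdicted_arcs :: "('v, 'e) pre_digraph \<Rightarrow> ('e \<Rightarrow> nat) \<Rightarrow> 'e set" where
  "interdicted_arcs G \<gamma> = {a \<in> arcs G. \<gamma> a = 1}"

definition interdicted_graph ::
  "('v, 'e) pre_digraph \<Rightarrow> ('e \<Rightarrow> nat) \<Rightarrow> ('v, 'e) pre_digraph" where
  "interdicted_graph G \<gamma> = G\<lparr>arcs := arcs G - interdicted_arcs G \<gamma>\<rparr>"

definition VAL ::
  "('v, 'e) pre_digraph \<Rightarrow> 'v \<Rightarrow> 'v \<Rightarrow> ('e \<Rightarrow> nat \<times> nat) \<Rightarrow> real \<times> real" where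
  "VAL G s t u = (max_flow_value G s t (\<lambda>a. fst (u a)), max_flow_value G s t (\<lambda>a. snd (u a)))"

definition efficient ::
  "('v, 'e) pre_digraph \<Rightarrow> 'v \<Rightarrow> 'v \<Rightarrow> ('e \<Rightarrow> nat \<times> nat) \<Rightarrow> ('e \<Rightarrow> nat) \<Rightarrow> nat \<Rightarrow> ('e \<Rightarrow> nat) \<Rightarrow> bool"
  where
  "efficient G s t u c B \<gamma> \<longleftrightarrow>
     \<gamma> \<in> strategies G c B \<and>
     \<not> (\<exists>\<gamma>' \<in> strategies G c B.
           VAL (interdicted_graph G \<gamma>') s t u \<prec> VAL (interdicted_graph G \<gamma>) s t u)"

definition nondominated_points ::
  "('v, 'e) pre_digraph \<Rightarrow> 'v \<Rightarrow> 'v \<Rightarrow> ('e \<Rightarrow> nat \<times> nat) \<Rightarrow> ('e \<Rightarrow> nat) \<Rightarrow> nat \<Rightarrow> (real \<times> real) set"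
  where
  "nondominated_points G s t u c B =
     {VAL (interdicted_graph G \<gamma>) s t u | \<gamma>. efficient G s t u c B \<gamma>}"


section \<open>Two-terminal series-parallel graphs\<close>

datatype 'e sp_tree =
    Primitive 'e
  | Parallel "'e sp_tree" "'e sp_tree"
  | Series "'e sp_tree" "'e sp_tree"

text \<open>
  \<open>sp_decomposition G s t T\<close>: the graph \<open>G\<close> with source \<open>s\<close> and sink \<open>t\<close> is two-terminal
  series-parallel and \<open>T\<close> is a decomposition tree of it. The graphs belonging to the subtrees of
  \<open>T\<close> are subgraphs of \<open>G\<close>, so the identification of terminals in a composition is expressed by
  the two parts having precisely the identified vertices (and no arcs) in common.
\<close>

inductive sp_decomposition :: "('v, 'e) pre_digraph \<Rightarrow> 'v \<Rightarrow> 'v \<Rightarrow> 'e sp_tree \<Rightarrow> bool" where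
  primitive:
    "\<lbrakk>verts G = {s, t}; s \<noteq> t; arcs G = {a}; tail G a = s; head G a = t\<rbrakk>
     \<Longrightarrow> sp_decomposition G s t (Primitive a)"
| parallel:
    "\<lbrakk>sp_decomposition G\<^sub>1 s t T\<^sub>1; sp_decomposition G\<^sub>2 s t T\<^sub>2; compatible G\<^sub>1 G\<^sub>2;
      verts G\<^sub>1 \<inter> verts G\<^sub>2 = {s, t}; arcs G\<^sub>1 \<inter> arcs G\<^sub>2 = {}\<rbrakk>
     \<Longrightarrow> sp_decomposition (union G\<^sub>1 G\<^sub>2) s t (Parallel T\<^sub>1 T\<^sub>2)"
| series:
    "\<lbrakk>sp_decomposition G\<^sub>1 s v T\<^sub>1; sp_decomposition G\<^sub>2 v t T\<^sub>2; compatible G\<^sub>1 G\<^sub>2;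
      verts G\<^sub>1 \<inter> verts G\<^sub>2 = {v}; arcs G\<^sub>1 \<inter> arcs G\<^sub>2 = {}\<rbrakk>
     \<Longrightarrow> sp_decomposition (union G\<^sub>1 G\<^sub>2) s t (Series T\<^sub>1 T\<^sub>2)"


section \<open>The label sets of the dynamic program\<close>

definition min_sum :: "(nat \<times> nat) set \<Rightarrow> (nat \<times> nat) set \<Rightarrow> (nat \<times> nat) set" (infixl "\<odot>" 70) where
  "R \<odot> S = {(min (fst r) (fst q), min (snd r) (snd q)) | r q. r \<in> R \<and> q \<in> S}"

text \<open>
  Distinct nodes of a decomposition tree belong to distinct subgraphs, as their arc sets differ.
  Hence labels indexed by the graphs of the tree can be indexed by its subtrees. The operation
  \<open>+\<close> on sets is the Minkowski sum.
\<close>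

primrec labels :: "('e \<Rightarrow> nat \<times> nat) \<Rightarrow> ('e \<Rightarrow> nat) \<Rightarrow> 'e sp_tree \<Rightarrow> nat \<Rightarrow> (nat \<times> nat) set" where
  "labels u c (Primitive a) x = (if x < c a then {(fst (u a), snd (u a))} else {(0, 0)})"
| "labels u c (Parallel T\<^sub>1 T\<^sub>2) x =
     minimal_points (\<Union>k \<in> {0..x}. labels u c T\<^sub>1 k + labels u c T\<^sub>2 (x - k))"
| "labels u c (Series T\<^sub>1 T\<^sub>2) x =
     minimal_points (\<Union>k \<in> {0..x}. labels u c T\<^sub>1 k \<odot> labels u c T\<^sub>2 (x - k))"

end

theory Submission
  imports Defs
begin

text \<open>
  Two facts make the recursion correct, one about flows and one about minimal points.

  The maximum flow value of a series-parallel graph is computed along its decomposition tree: it is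
  additive under parallel composition and the minimum of the two values under series composition
  (\<open>sp_max_flow_value\<close>). The reason is that a flow in a composition is precisely a pair of flows
  in the parts, with equal values in the series case
  (\<open>is_flow_parallel\<close>, \<open>is_flow_series\<close>). Interdicting arcs has the same effect as setting their
  capacity to zero (\<open>max_flow_value_interdicted_graph\<close>), so the graph and its tree can stay fixed
  while only the capacities vary. The objective vector of a strategy is therefore a function of the
  set \<open>S\<close> of interdicted leaves of the tree, called \<open>outcome\<close> below.

  Since the two parts of a composition have disjoint leaf sets, spending a budget \<open>x\<close> on the
  composition is the same as spending some \<open>k \<le> x\<close> on the first part and \<open>x - k\<close> on the second.
  Hence the set of all outcomes affordable with budget \<open>x\<close> obeys the recursion for the labels,
  but without the minimisation (\<open>outcomes_composition\<close>). Minimising in every intermediate step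
  loses nothing: in \<open>\<nat>\<^sup>2\<close> every point of a set lies above a minimal one, and both addition and the
  componentwise minimum are monotone (\<open>minimal_points_Union_minimal_points\<close>). By induction the
  labels are the minimal affordable outcomes (\<open>labels_eq_minimal_outcomes\<close>), and these are the
  non-dominated points.
\<close>

section \<open>Structure of series-parallel graphs\<close>

lemma sp_terminals:
  assumes "sp_decomposition G s t T"
  shows "s \<in> verts G" "t \<in> verts G" "s \<noteq> t"
proof -
  have "s \<in> verts G \<and> t \<in> verts G \<and> s \<noteq> t"
    using assms by (induction rule: sp_decomposition.induct) auto
  then show "s \<in> verts G" "t \<in> verts G" "s \<noteq> t" by auto
qed

lemma fin_digraph_union:
  assumes "fin_digraph G\<^sub>1" "fin_digraph G\<^sub>2" "compatible G\<^sub>1 G\<^sub>2"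
  shows "fin_digraph (union G\<^sub>1 G\<^sub>2)"
proof -
  interpret G1: fin_digraph G\<^sub>1 by fact
  interpret G2: fin_digraph G\<^sub>2 by fact
  have "tail G\<^sub>1 = tail G\<^sub>2" "head G\<^sub>1 = head G\<^sub>2" using assms(3) by (auto simp: compatible_def)
  then show ?thesis
    using G1.tail_in_verts G2.tail_in_verts G1.head_in_verts G2.head_in_verts
    by unfold_locales auto
qed

lemma sp_fin_digraph: "sp_decomposition G s t T \<Longrightarrow> fin_digraph G"
proof (induction rule: sp_decomposition.induct)
  case (primitive G s t a)
  then show ?case by unfold_locales auto
next
  case (parallel G1 s t T1 G2 T2)
  then show ?case by (intro fin_digraph_union)
next
  case (series G1 s v T1 G2 t T2)
  then show ?case by (intro fin_digraph_union)
qed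

lemma set_sp_tree_eq_arcs: "sp_decomposition G s t T \<Longrightarrow> set_sp_tree T = arcs G"
  by (induction rule: sp_decomposition.induct) auto

lemma in_arcs_union:
  "compatible G\<^sub>1 G\<^sub>2 \<Longrightarrow> in_arcs (union G\<^sub>1 G\<^sub>2) v = in_arcs G\<^sub>1 v \<union> in_arcs G\<^sub>2 v"
  by (auto simp: in_arcs_def compatible_def)

lemma out_arcs_union:
  "compatible G\<^sub>1 G\<^sub>2 \<Longrightarrow> out_arcs (union G\<^sub>1 G\<^sub>2) v = out_arcs G\<^sub>1 v \<union> out_arcs G\<^sub>2 v"
  by (auto simp: out_arcs_def compatible_def)

lemma (in wf_digraph) incident_arcs_outside:
  "v \<notin> verts G \<Longrightarrow> in_arcs G v = {}" "v \<notin> verts G \<Longrightarrow> out_arcs G v = {}"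
  by (auto simp: in_arcs_def out_arcs_def)

lemma sp_incident_outside:
  assumes "sp_decomposition G s t T" "v \<notin> verts G"
  shows "in_arcs G v = {}" "out_arcs G v = {}"
proof -
  interpret fin_digraph G using assms(1) by (rule sp_fin_digraph)
  show "in_arcs G v = {}" "out_arcs G v = {}" using incident_arcs_outside assms(2) by auto
qed

text \<open>
  With no arc entering the source or leaving the sink, the value of a flow is just the outflow of
  the source, and at the middle vertex of a series composition all arcs of the first part enter
  while all arcs of the second part leave.
\<close>

lemma sp_terminal_arcs:
  assumes "sp_decomposition G s t T"
  shows "in_arcs G s = {}" "out_arcs G t = {}"
proof -
  have "in_arcs G s = {} \<and> out_arcs G t = {}"
    using assms
  proof (induction rule: sp_decomposition.induct)
    case (primitive G s t a)
    then show ?case by (auto simp: in_arcs_def out_arcs_def)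
  next
    case (parallel G1 s t T1 G2 T2)
    then show ?case by (simp add: in_arcs_union out_arcs_union)
  next
    case (series G1 s v T1 G2 t T2)
    have "s \<notin> verts G2" "t \<notin> verts G1"
      using series.hyps sp_terminals[OF series.hyps(1)] sp_terminals[OF series.hyps(2)] by auto
    then show ?case
      using series sp_incident_outside[OF series.hyps(1)] sp_incident_outside[OF series.hyps(2)]
      by (simp add: in_arcs_union out_arcs_union)
  qed
  then show "in_arcs G s = {}" "out_arcs G t = {}" by auto
qed

section \<open>Flows in compositions\<close>

lemma is_flow_cong:
  assumes "\<And>a. a \<in> arcs G \<Longrightarrow> f a = g a"
  shows "is_flow G s t w f \<longleftrightarrow> is_flow G s t w g"
proof -
  have "sum f (in_arcs G v) = sum g (in_arcs G v)" "sum f (out_arcs G v) = sum g (out_arcs G v)" for v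
    using assms by (auto intro: sum.cong simp: in_arcs_def out_arcs_def)
  then show ?thesis using assms by (simp add: is_flow_def)
qed

text \<open>
  An inner vertex of one part is not a vertex of the other part, so that its conservation constraint
  in the composition is the one in its own part.
\<close>

lemma is_flow_parallel:
  assumes "sp_decomposition G\<^sub>1 s t T\<^sub>1" "sp_decomposition G\<^sub>2 s t T\<^sub>2" "compatible G\<^sub>1 G\<^sub>2"
    "verts G\<^sub>1 \<inter> verts G\<^sub>2 = {s, t}"
  shows "is_flow (union G\<^sub>1 G\<^sub>2) s t w f \<longleftrightarrow> is_flow G\<^sub>1 s t w f \<and> is_flow G\<^sub>2 s t w f"
proof -
  have "in_arcs (union G\<^sub>1 G\<^sub>2) v = in_arcs G\<^sub>1 v" "out_arcs (union G\<^sub>1 G\<^sub>2) v = out_arcs G\<^sub>1 v"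
    if "v \<in> verts G\<^sub>1 - {s, t}" for v
  proof -
    have "v \<notin> verts G\<^sub>2" using that assms(4) by auto
    then show "in_arcs (union G\<^sub>1 G\<^sub>2) v = in_arcs G\<^sub>1 v" "out_arcs (union G\<^sub>1 G\<^sub>2) v = out_arcs G\<^sub>1 v"
      using sp_incident_outside[OF assms(2)] assms(3) by (simp_all add: in_arcs_union out_arcs_union)
  qed
  moreover have "in_arcs (union G\<^sub>1 G\<^sub>2) v = in_arcs G\<^sub>2 v" "out_arcs (union G\<^sub>1 G\<^sub>2) v = out_arcs G\<^sub>2 v"
    if "v \<in> verts G\<^sub>2 - {s, t}" for v
  proof -
    have "v \<notin> verts G\<^sub>1" using that assms(4) by auto
    then show "in_arcs (union G\<^sub>1 G\<^sub>2) v = in_arcs G\<^sub>2 v" "out_arcs (union G\<^sub>1 G\<^sub>2) v = out_arcs G\<^sub>2 v"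
      using sp_incident_outside[OF assms(1)] assms(3) by (simp_all add: in_arcs_union out_arcs_union)
  qed
  ultimately show ?thesis
    unfolding is_flow_def by (simp add: ball_Un Un_Diff) blast
qed

text \<open>
  Compared with the two parts, the composition has one more conservation constraint, the one at the
  middle vertex \<open>v\<close>; it couples the two flows.
\<close>

lemma is_flow_series:
  assumes "sp_decomposition G\<^sub>1 s v T\<^sub>1" "sp_decomposition G\<^sub>2 v t T\<^sub>2" "compatible G\<^sub>1 G\<^sub>2"
    "verts G\<^sub>1 \<inter> verts G\<^sub>2 = {v}"
  shows "is_flow (union G\<^sub>1 G\<^sub>2) s t w f \<longleftrightarrow>
    is_flow G\<^sub>1 s v w f \<and> is_flow G\<^sub>2 v t w f \<and> sum f (in_arcs G\<^sub>1 v) = sum f (out_arcs G\<^sub>2 v)"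
proof -
  note terminals = sp_terminals[OF assms(1)] sp_terminals[OF assms(2)]
  have "in_arcs (union G\<^sub>1 G\<^sub>2) x = in_arcs G\<^sub>1 x" "out_arcs (union G\<^sub>1 G\<^sub>2) x = out_arcs G\<^sub>1 x"
    if "x \<in> verts G\<^sub>1 - {s, v}" for x
  proof -
    have "x \<notin> verts G\<^sub>2" using that assms(4) by auto
    then show "in_arcs (union G\<^sub>1 G\<^sub>2) x = in_arcs G\<^sub>1 x" "out_arcs (union G\<^sub>1 G\<^sub>2) x = out_arcs G\<^sub>1 x"
      using sp_incident_outside[OF assms(2)] assms(3) by (simp_all add: in_arcs_union out_arcs_union)
  qed
  moreover have "in_arcs (union G\<^sub>1 G\<^sub>2) x = in_arcs G\<^sub>2 x" "out_arcs (union G\<^sub>1 G\<^sub>2) x = out_arcs G\<^sub>2 x"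
    if "x \<in> verts G\<^sub>2 - {v, t}" for x
  proof -
    have "x \<notin> verts G\<^sub>1" using that assms(4) by auto
    then show "in_arcs (union G\<^sub>1 G\<^sub>2) x = in_arcs G\<^sub>2 x" "out_arcs (union G\<^sub>1 G\<^sub>2) x = out_arcs G\<^sub>2 x"
      using sp_incident_outside[OF assms(1)] assms(3) by (simp_all add: in_arcs_union out_arcs_union)
  qed
  moreover have "in_arcs (union G\<^sub>1 G\<^sub>2) v = in_arcs G\<^sub>1 v" "out_arcs (union G\<^sub>1 G\<^sub>2) v = out_arcs G\<^sub>2 v"
    using sp_terminal_arcs[OF assms(1)] sp_terminal_arcs[OF assms(2)] assms(3)
    by (simp_all add: in_arcs_union out_arcs_union)
  moreover have "verts (union G\<^sub>1 G\<^sub>2) - {s, t}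
      = (verts G\<^sub>1 - {s, v}) \<union> (verts G\<^sub>2 - {v, t}) \<union> {v}"
    using terminals assms(4) by auto
  ultimately show ?thesis
    unfolding is_flow_def by (simp add: ball_Un) blast
qed

lemma sp_flow_value:
  "sp_decomposition G s t T \<Longrightarrow> flow_value G s f = sum f (out_arcs G s)"
  by (simp add: flow_value_def sp_terminal_arcs)

lemma sum_disjoint_parts:
  fixes f :: "'e \<Rightarrow> real"
  assumes "fin_digraph G\<^sub>1" "fin_digraph G\<^sub>2" "compatible G\<^sub>1 G\<^sub>2" "arcs G\<^sub>1 \<inter> arcs G\<^sub>2 = {}"
  shows "sum f (out_arcs (union G\<^sub>1 G\<^sub>2) v) = sum f (out_arcs G\<^sub>1 v) + sum f (out_arcs G\<^sub>2 v)"
    and "sum f (in_arcs (union G\<^sub>1 G\<^sub>2) v) = sum f (in_arcs G\<^sub>1 v) + sum f (in_arcs G\<^sub>2 v)"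
proof -
  interpret G1: fin_digraph G\<^sub>1 by fact
  interpret G2: fin_digraph G\<^sub>2 by fact
  have "out_arcs G\<^sub>1 v \<inter> out_arcs G\<^sub>2 v = {}" "in_arcs G\<^sub>1 v \<inter> in_arcs G\<^sub>2 v = {}"
    using assms(4) by (auto simp: in_arcs_def out_arcs_def)
  moreover have "finite (out_arcs G\<^sub>1 v)" "finite (out_arcs G\<^sub>2 v)"
      "finite (in_arcs G\<^sub>1 v)" "finite (in_arcs G\<^sub>2 v)"
    by (simp_all add: in_arcs_def out_arcs_def)
  ultimately show "sum f (out_arcs (union G\<^sub>1 G\<^sub>2) v) = sum f (out_arcs G\<^sub>1 v) + sum f (out_arcs G\<^sub>2 v)"
    "sum f (in_arcs (union G\<^sub>1 G\<^sub>2) v) = sum f (in_arcs G\<^sub>1 v) + sum f (in_arcs G\<^sub>2 v)"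
    using assms(3) by (simp_all add: in_arcs_union out_arcs_union sum.union_disjoint)
qed

section \<open>The maximum flow value of a series-parallel graph\<close>

text \<open>
  The maximum flow value under the capacities \<open>w\<close> of the graph with decomposition tree \<open>T\<close>; it is
  read off from the tree alone.
\<close>

primrec sp_capacity :: "('e \<Rightarrow> nat) \<Rightarrow> 'e sp_tree \<Rightarrow> nat" where
  "sp_capacity w (Primitive a) = w a"
| "sp_capacity w (Parallel T\<^sub>1 T\<^sub>2) = sp_capacity w T\<^sub>1 + sp_capacity w T\<^sub>2"
| "sp_capacity w (Series T\<^sub>1 T\<^sub>2) = min (sp_capacity w T\<^sub>1) (sp_capacity w T\<^sub>2)"

text \<open>
  Together with the constraint at the middle vertex, this makes the two parts of a series
  composition carry flows of the same value.
\<close>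

lemma sp_source_outflow_eq_sink_inflow:
  assumes "sp_decomposition G s t T" "is_flow G s t w f"
  shows "sum f (out_arcs G s) = sum f (in_arcs G t)"
  using assms
proof (induction rule: sp_decomposition.induct)
  case (primitive G s t a)
  then have "out_arcs G s = {a}" "in_arcs G t = {a}" by (auto simp: in_arcs_def out_arcs_def)
  then show ?case by simp
next
  case (parallel G1 s t T1 G2 T2)
  then show ?case
    by (simp add: is_flow_parallel[OF parallel.hyps(1-4)] sum_disjoint_parts sp_fin_digraph)
next
  case (series G1 s v T1 G2 t T2)
  have "s \<notin> verts G2" "t \<notin> verts G1"
    using series.hyps sp_terminals[OF series.hyps(1)] sp_terminals[OF series.hyps(2)] by auto
  then have "out_arcs (union G1 G2) s = out_arcs G1 s" "in_arcs (union G1 G2) t = in_arcs G2 t"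
    using series.hyps(3) sp_incident_outside[OF series.hyps(1)] sp_incident_outside[OF series.hyps(2)]
    by (simp_all add: in_arcs_union out_arcs_union)
  then show ?case using series by (simp add: is_flow_series[OF series.hyps(1-4)])
qed

lemma series_out_arcs:
  assumes "sp_decomposition G\<^sub>1 s v T\<^sub>1" "sp_decomposition G\<^sub>2 v t T\<^sub>2" "compatible G\<^sub>1 G\<^sub>2"
    "verts G\<^sub>1 \<inter> verts G\<^sub>2 = {v}"
  shows "out_arcs (union G\<^sub>1 G\<^sub>2) s = out_arcs G\<^sub>1 s"
proof -
  have "s \<notin> verts G\<^sub>2" using assms(4) sp_terminals[OF assms(1)] by auto
  then show ?thesis using assms(3) sp_incident_outside[OF assms(2)] by (simp add: out_arcs_union)
qed

lemma sp_flow_value_le_capacity: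
  assumes "sp_decomposition G s t T" "is_flow G s t w f"
  shows "flow_value G s f \<le> real (sp_capacity w T)"
proof -
  have "sum f (out_arcs G s) \<le> real (sp_capacity w T)"
    using assms
  proof (induction rule: sp_decomposition.induct)
    case (primitive G s t a)
    then have "out_arcs G s = {a}" by (auto simp: out_arcs_def)
    then show ?case using primitive by (simp add: is_flow_def)
  next
    case (parallel G1 s t T1 G2 T2)
    then show ?case
      by (simp add: is_flow_parallel[OF parallel.hyps(1-4)] sum_disjoint_parts sp_fin_digraph
          add_mono)
  next
    case (series G1 s v T1 G2 t T2)
    then have flows: "is_flow G1 s v w f" "is_flow G2 v t w f"
        "sum f (in_arcs G1 v) = sum f (out_arcs G2 v)"
      by (simp_all add: is_flow_series[OF series.hyps(1-4)])
    have "sum f (out_arcs G1 s) = sum f (out_arcs G2 v)"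
      using sp_source_outflow_eq_sink_inflow[OF series.hyps(1) flows(1)] flows(3) by simp
    then show ?case
      using series.IH flows by (simp add: series_out_arcs[OF series.hyps(1-4)] of_nat_min)
  qed
  then show ?thesis using assms(1) by (simp add: sp_flow_value)
qed

text \<open>
  Maximum flows alone would be too weak an induction hypothesis: in a series composition, a part
  whose capacity exceeds that of the other must carry a flow that is not maximum. Hence every value
  up to the capacity is realised.
\<close>

lemma sp_flow_of_value:
  assumes "sp_decomposition G s t T" "0 \<le> r" "r \<le> real (sp_capacity w T)"
  shows "\<exists>f. is_flow G s t w f \<and> flow_value G s f = r"
proof -
  have "\<exists>f. is_flow G s t w f \<and> sum f (out_arcs G s) = r"
    using assms
  proof (induction arbitrary: r rule: sp_decomposition.induct)
    case (primitive G s t a)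
    then have "out_arcs G s = {a}" by (auto simp: out_arcs_def)
    then show ?case using primitive
      by (intro exI[of _ "\<lambda>_. r"]) (auto simp: is_flow_def)
  next
    case (parallel G1 s t T1 G2 T2)
    \<comment> \<open>Any split that respects both capacities will do; this one fills the first part greedily.\<close>
    let ?r1 = "min r (real (sp_capacity w T1))"
    have split: "0 \<le> ?r1" "?r1 \<le> sp_capacity w T1" "0 \<le> r - ?r1" "r - ?r1 \<le> sp_capacity w T2"
      using parallel.prems by auto
    obtain f1 f2 where f: "is_flow G1 s t w f1" "sum f1 (out_arcs G1 s) = ?r1"
        "is_flow G2 s t w f2" "sum f2 (out_arcs G2 s) = r - ?r1"
      using parallel.IH(1)[of ?r1] parallel.IH(2)[of "r - ?r1"] split by blast
    define f where "f a = (if a \<in> arcs G1 then f1 a else f2 a)" for a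
    have eq: "\<And>a. a \<in> arcs G1 \<Longrightarrow> f a = f1 a" "\<And>a. a \<in> arcs G2 \<Longrightarrow> f a = f2 a"
      using parallel.hyps(5) by (auto simp: f_def)
    have "is_flow (union G1 G2) s t w f"
      using f is_flow_cong[of G1 f f1] is_flow_cong[of G2 f f2] eq
      by (simp add: is_flow_parallel[OF parallel.hyps(1-4)])
    moreover have "sum f (out_arcs G1 s) = sum f1 (out_arcs G1 s)"
      "sum f (out_arcs G2 s) = sum f2 (out_arcs G2 s)"
      using eq by (auto intro!: sum.cong simp: out_arcs_def)
    ultimately show ?case
      using f parallel.hyps by (intro exI[of _ f]) (simp add: sum_disjoint_parts sp_fin_digraph)
  next
    case (series G1 s v T1 G2 t T2)
    obtain f1 f2 where f: "is_flow G1 s v w f1" "sum f1 (out_arcs G1 s) = r"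
        "is_flow G2 v t w f2" "sum f2 (out_arcs G2 v) = r"
      using series.IH(1)[of r] series.IH(2)[of r] series.prems by (auto simp: of_nat_min)
    define f where "f a = (if a \<in> arcs G1 then f1 a else f2 a)" for a
    have eq: "\<And>a. a \<in> arcs G1 \<Longrightarrow> f a = f1 a" "\<And>a. a \<in> arcs G2 \<Longrightarrow> f a = f2 a"
      using series.hyps(5) by (auto simp: f_def)
    have sums: "sum f (out_arcs G1 s) = sum f1 (out_arcs G1 s)"
      "sum f (in_arcs G1 v) = sum f1 (in_arcs G1 v)"
      "sum f (out_arcs G2 v) = sum f2 (out_arcs G2 v)"
      using eq by (auto intro!: sum.cong simp: out_arcs_def in_arcs_def)
    have "sum f1 (in_arcs G1 v) = r"
      using sp_source_outflow_eq_sink_inflow[OF series.hyps(1) f(1)] f(2) by simp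
    then have "is_flow (union G1 G2) s t w f"
      using f is_flow_cong[of G1 f f1] is_flow_cong[of G2 f f2] eq sums
      by (simp add: is_flow_series[OF series.hyps(1-4)])
    then show ?case
      using f sums by (intro exI[of _ f]) (simp add: series_out_arcs[OF series.hyps(1-4)])
  qed
  then show ?thesis using assms(1) by (simp add: sp_flow_value)
qed

theorem sp_max_flow_value:
  assumes "sp_decomposition G s t T"
  shows "max_flow_value G s t w = real (sp_capacity w T)"
  unfolding max_flow_value_def
proof (rule Greatest_equality)
  show "\<exists>f. is_flow G s t w f \<and> real (sp_capacity w T) = flow_value G s f"
    using sp_flow_of_value[OF assms, of "real (sp_capacity w T)" w] by auto
qed (use sp_flow_value_le_capacity[OF assms] in auto)

section \<open>Interdiction as a change of capacities\<close>

definition interdict :: "'e set \<Rightarrow> ('e \<Rightarrow> nat) \<Rightarrow> 'e \<Rightarrow> nat" where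
  "interdict S w a = (if a \<in> S then 0 else w a)"

text \<open>
  A function that vanishes on the interdicted arcs is a flow in one graph iff it is one in the
  other, with the same value. A flow for the reduced capacities vanishes there by itself; a flow in
  the interdicted graph has arbitrary values there and must first be reset to zero.
\<close>

lemma max_flow_value_interdicted_graph:
  assumes "fin_digraph G"
  shows "max_flow_value (interdicted_graph G \<gamma>) s t w
    = max_flow_value G s t (interdict (interdicted_arcs G \<gamma>) w)"
proof -
  interpret fin_digraph G by fact
  define I where "I = interdicted_arcs G \<gamma>"
  let ?H = "interdicted_graph G \<gamma>"
  have H: "verts ?H = verts G" "arcs ?H = arcs G - I"
      "in_arcs ?H v = in_arcs G v - I" "out_arcs ?H v = out_arcs G v - I" for v
    by (auto simp: interdicted_graph_def I_def in_arcs_def out_arcs_def)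
  have sums: "sum f (in_arcs ?H v) = sum f (in_arcs G v)"
      "sum f (out_arcs ?H v) = sum f (out_arcs G v)"
    if "\<And>a. a \<in> arcs G \<inter> I \<Longrightarrow> f a = 0" for f :: "'b \<Rightarrow> real" and v
    unfolding H using that by (auto intro!: sum.mono_neutral_left)
  have vanish: "is_flow G s t (interdict I w) f \<longleftrightarrow> is_flow ?H s t w f"
      "flow_value ?H s f = flow_value G s f"
    if f: "\<And>a. a \<in> arcs G \<inter> I \<Longrightarrow> f a = 0" for f
  proof -
    have "(\<forall>a\<in>arcs G. 0 \<le> f a \<and> f a \<le> real (interdict I w a)) \<longleftrightarrow>
        (\<forall>a\<in>arcs ?H. 0 \<le> f a \<and> f a \<le> real (w a))"
      using f by (auto simp: H interdict_def)
    moreover have same_sums: "sum f (in_arcs ?H v) = sum f (in_arcs G v)"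
        "sum f (out_arcs ?H v) = sum f (out_arcs G v)" for v
      using sums[of f v] f by blast+
    ultimately show "is_flow G s t (interdict I w) f \<longleftrightarrow> is_flow ?H s t w f"
      by (simp add: is_flow_def H(1))
    show "flow_value ?H s f = flow_value G s f"
      by (simp add: flow_value_def same_sums)
  qed
  have "(\<exists>f. is_flow ?H s t w f \<and> r = flow_value ?H s f) \<longleftrightarrow>
      (\<exists>f. is_flow G s t (interdict I w) f \<and> r = flow_value G s f)" for r
  proof
    assume "\<exists>f. is_flow ?H s t w f \<and> r = flow_value ?H s f"
    then obtain f where f: "is_flow ?H s t w f" "r = flow_value ?H s f" by auto
    define g where "g a = (if a \<in> I then 0 else f a)" for a
    have "is_flow ?H s t w g"
      using f(1) is_flow_cong[of ?H g f] by (simp add: g_def H)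
    moreover have "flow_value ?H s g = flow_value ?H s f"
      unfolding flow_value_def by (auto simp: g_def H intro!: arg_cong2[of _ _ _ _ minus] sum.cong)
    ultimately show "\<exists>f. is_flow G s t (interdict I w) f \<and> r = flow_value G s f"
      using f vanish[of g] by (auto simp: g_def)
  next
    assume "\<exists>f. is_flow G s t (interdict I w) f \<and> r = flow_value G s f"
    then obtain f where f: "is_flow G s t (interdict I w) f" "r = flow_value G s f" by auto
    have "f a = 0" if "a \<in> arcs G \<inter> I" for a
      using f(1) that by (force simp: is_flow_def interdict_def)
    then show "\<exists>f. is_flow ?H s t w f \<and> r = flow_value ?H s f"
      using f vanish[of f] by auto
  qed
  then show ?thesis by (simp add: max_flow_value_def I_def)
qed

section \<open>Minimal points\<close>

text \<open>
  A dominating point has a smaller coordinate sum, so dominance is well-founded on \<open>\<nat>\<^sup>2\<close>.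
\<close>

lemma minimal_point_below:
  fixes S :: "(nat \<times> nat) set"
  assumes "z \<in> S"
  obtains y where "y \<in> minimal_points S" "fst y \<le> fst z" "snd y \<le> snd z"
proof -
  have "\<exists>y \<in> minimal_points S. fst y \<le> fst z \<and> snd y \<le> snd z"
    using assms
  proof (induction "fst z + snd z" arbitrary: z rule: less_induct)
    case less
    show ?case
    proof (cases "z \<in> minimal_points S")
      case False
      then obtain y where y: "y \<in> S" "y \<prec> z"
        using less.prems by (auto simp: minimal_points_def)
      then have "fst y + snd y < fst z + snd z"
        by (cases y; cases z) (auto simp: pt_dominates_def)
      then obtain x where "x \<in> minimal_points S" "fst x \<le> fst y" "snd x \<le> snd y"
        using less.hyps[of y] y(1) by auto
      with y(2) show ?thesis by (intro bexI[of _ x]) (auto simp: pt_dominates_def)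
    qed auto
  qed
  then show thesis using that by auto
qed

lemma minimal_points_subset: "minimal_points S \<subseteq> S"
  by (auto simp: minimal_points_def)

lemma minimal_points_eqI:
  fixes R S :: "('n::order \<times> 'n) set"
  assumes "R \<subseteq> S"
    and "\<And>z. z \<in> S \<Longrightarrow> \<exists>y \<in> R. fst y \<le> fst z \<and> snd y \<le> snd z"
  shows "minimal_points R = minimal_points S"
proof (intro set_eqI iffI)
  fix z assume z: "z \<in> minimal_points R"
  have "\<not> y \<prec> z" if y: "y \<in> S" for y
  proof
    assume "y \<prec> z"
    obtain x where "x \<in> R" "fst x \<le> fst y" "snd x \<le> snd y" using assms(2)[OF y] by auto
    with \<open>y \<prec> z\<close> have "x \<prec> z"
      by (cases x; cases y; cases z) (auto simp: pt_dominates_def)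
    with \<open>x \<in> R\<close> z show False by (auto simp: minimal_points_def)
  qed
  with z assms(1) show "z \<in> minimal_points S" by (auto simp: minimal_points_def)
next
  fix z assume z: "z \<in> minimal_points S"
  then have "z \<in> S" by (simp add: minimal_points_def)
  then obtain y where y: "y \<in> R" "fst y \<le> fst z" "snd y \<le> snd z"
    using assms(2) by blast
  then have "y = z" using z assms(1) by (auto simp: minimal_points_def pt_dominates_def)
  with z y assms(1) show "z \<in> minimal_points R" by (auto simp: minimal_points_def)
qed

text \<open>
  This justifies discarding dominated labels early: lowering both arguments of a monotone operation
  can only lower its result.
\<close>

lemma minimal_points_Union_minimal_points:
  fixes f :: "nat \<times> nat \<Rightarrow> nat \<times> nat \<Rightarrow> nat \<times> nat"
  assumes mono: "\<And>p p' q q'. \<lbrakk>fst p \<le> fst p'; snd p \<le> snd p'; fst q \<le> fst q'; snd q \<le> snd q'\<rbrakk>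
      \<Longrightarrow> fst (f p q) \<le> fst (f p' q') \<and> snd (f p q) \<le> snd (f p' q')"
  shows "minimal_points (\<Union>k\<in>K. {f p q | p q. p \<in> minimal_points (P k) \<and> q \<in> minimal_points (Q k)})
    = minimal_points (\<Union>k\<in>K. {f p q | p q. p \<in> P k \<and> q \<in> Q k})"
proof (rule minimal_points_eqI)
  show "(\<Union>k\<in>K. {f p q | p q. p \<in> minimal_points (P k) \<and> q \<in> minimal_points (Q k)})
      \<subseteq> (\<Union>k\<in>K. {f p q | p q. p \<in> P k \<and> q \<in> Q k})"
    using minimal_points_subset by blast
next
  fix z assume "z \<in> (\<Union>k\<in>K. {f p q | p q. p \<in> P k \<and> q \<in> Q k})"
  then obtain k p q where z: "k \<in> K" "p \<in> P k" "q \<in> Q k" "z = f p q" by auto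
  obtain p' where p': "p' \<in> minimal_points (P k)" "fst p' \<le> fst p" "snd p' \<le> snd p"
    using z by (rule_tac minimal_point_below)
  obtain q' where q': "q' \<in> minimal_points (Q k)" "fst q' \<le> fst q" "snd q' \<le> snd q"
    using z by (rule_tac minimal_point_below)
  show "\<exists>y \<in> (\<Union>k\<in>K. {f p q | p q. p \<in> minimal_points (P k) \<and> q \<in> minimal_points (Q k)}).
      fst y \<le> fst z \<and> snd y \<le> snd z"
    using p' q' z mono[of p' p q' q] by (intro bexI[of _ "f p' q'"]) blast+
qed

section \<open>Correctness of the labels\<close>

definition outcome :: "('e \<Rightarrow> nat \<times> nat) \<Rightarrow> 'e sp_tree \<Rightarrow> 'e set \<Rightarrow> nat \<times> nat" where
  "outcome u T S = (sp_capacity (interdict S (\<lambda>a. fst (u a))) T,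
                    sp_capacity (interdict S (\<lambda>a. snd (u a))) T)"

definition outcomes :: "('e \<Rightarrow> nat \<times> nat) \<Rightarrow> ('e \<Rightarrow> nat) \<Rightarrow> 'e sp_tree \<Rightarrow> nat \<Rightarrow> (nat \<times> nat) set" where
  "outcomes u c T x = {outcome u T S | S. S \<subseteq> set_sp_tree T \<and> sum c S \<le> x}"

lemma sp_capacity_cong:
  "(\<And>a. a \<in> set_sp_tree T \<Longrightarrow> w a = w' a) \<Longrightarrow> sp_capacity w T = sp_capacity w' T"
  by (induction T) auto

lemma outcome_restrict: "outcome u T (S \<inter> set_sp_tree T) = outcome u T S"
  unfolding outcome_def by (auto intro!: sp_capacity_cong simp: interdict_def)

lemma finite_set_sp_tree: "finite (set_sp_tree T)"
  by (induction T) auto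

text \<open>
  A set of interdicted arcs of the composition is the disjoint union of its restrictions to the two
  parts, and its cost is the sum of theirs. If it is affordable with budget \<open>x\<close>, then the cost of
  its first restriction is a suitable \<open>k\<close>.
\<close>

lemma outcomes_composition:
  assumes f: "\<And>S. outcome u T S = f (outcome u T\<^sub>1 S) (outcome u T\<^sub>2 S)"
    and leaves: "set_sp_tree T = set_sp_tree T\<^sub>1 \<union> set_sp_tree T\<^sub>2"
    and disj: "set_sp_tree T\<^sub>1 \<inter> set_sp_tree T\<^sub>2 = {}"
  shows "outcomes u c T x =
    (\<Union>k \<in> {0..x}. {f p q | p q. p \<in> outcomes u c T\<^sub>1 k \<and> q \<in> outcomes u c T\<^sub>2 (x - k)})"
proof (intro set_eqI iffI)
  fix z assume "z \<in> outcomes u c T x"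
  then obtain S where S: "S \<subseteq> set_sp_tree T" "sum c S \<le> x" "z = outcome u T S"
    by (auto simp: outcomes_def)
  let ?S1 = "S \<inter> set_sp_tree T\<^sub>1" and ?S2 = "S \<inter> set_sp_tree T\<^sub>2"
  have "S = ?S1 \<union> ?S2" using S(1) leaves by auto
  moreover have "?S1 \<inter> ?S2 = {}" using disj by auto
  ultimately have "sum c S = sum c ?S1 + sum c ?S2"
    using sum.union_disjoint[of ?S1 ?S2 c] finite_set_sp_tree[of T\<^sub>1] finite_set_sp_tree[of T\<^sub>2]
    by simp
  then have "sum c ?S1 \<in> {0..x}" "sum c ?S2 \<le> x - sum c ?S1" using S(2) by auto
  moreover have "z = f (outcome u T\<^sub>1 ?S1) (outcome u T\<^sub>2 ?S2)"
    by (simp add: S(3) f outcome_restrict)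
  ultimately show "z \<in> (\<Union>k \<in> {0..x}. {f p q | p q. p \<in> outcomes u c T\<^sub>1 k \<and> q \<in> outcomes u c T\<^sub>2 (x - k)})"
    unfolding outcomes_def by blast
next
  fix z
  assume "z \<in> (\<Union>k \<in> {0..x}. {f p q | p q. p \<in> outcomes u c T\<^sub>1 k \<and> q \<in> outcomes u c T\<^sub>2 (x - k)})"
  then obtain k S1 S2 where S: "k \<le> x" "S1 \<subseteq> set_sp_tree T\<^sub>1" "sum c S1 \<le> k"
      "S2 \<subseteq> set_sp_tree T\<^sub>2" "sum c S2 \<le> x - k" "z = f (outcome u T\<^sub>1 S1) (outcome u T\<^sub>2 S2)"
    by (auto simp: outcomes_def)
  have "(S1 \<union> S2) \<inter> set_sp_tree T\<^sub>1 = S1" "(S1 \<union> S2) \<inter> set_sp_tree T\<^sub>2 = S2"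
    using S disj by auto
  then have "z = outcome u T (S1 \<union> S2)"
    using outcome_restrict[of u T\<^sub>1 "S1 \<union> S2"] outcome_restrict[of u T\<^sub>2 "S1 \<union> S2"]
    by (simp add: S f)
  moreover have "sum c (S1 \<union> S2) \<le> sum c S1 + sum c S2"
    using finite_subset[OF S(2) finite_set_sp_tree] finite_subset[OF S(4) finite_set_sp_tree]
    by (simp add: sum_Un_nat)
  then have "sum c (S1 \<union> S2) \<le> x" using S by linarith
  ultimately show "z \<in> outcomes u c T x"
    using S leaves unfolding outcomes_def by blast
qed

lemma plus_as_image: "R + S = {p + q | p q. p \<in> R \<and> q \<in> (S :: (nat \<times> nat) set)}"
  unfolding set_plus_def by blast

text \<open>
  At a leaf with \<open>c a \<le> x\<close> not interdicting \<open>a\<close> remains possible, but its outcome \<open>u a\<close> is either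
  dominated by \<open>(0, 0)\<close> or equal to it. At an inner node the recursion for the outcomes applies,
  and the labels of the children may be replaced by all of their outcomes.
\<close>

lemma labels_eq_minimal_outcomes:
  assumes "sp_decomposition G s t T"
  shows "labels u c T x = minimal_points (outcomes u c T x)"
  using assms
proof (induction arbitrary: x rule: sp_decomposition.induct)
  case (primitive G s t a)
  have "outcomes u c (Primitive a) x = outcome u (Primitive a) ` {S \<in> {{}, {a}}. sum c S \<le> x}"
    by (auto simp: outcomes_def subset_singleton_iff)
  also have "{S \<in> {{}, {a}}. sum c S \<le> x} = (if x < c a then {{}} else {{}, {a}})"
    by auto
  finally have "outcomes u c (Primitive a) x = (if x < c a then {u a} else {u a, (0, 0)})"
    by (simp add: outcome_def interdict_def)
  then show ?case by (cases "u a") (auto simp: minimal_points_def pt_dominates_def)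
next
  case (parallel G1 s t T1 G2 T2)
  have disj: "set_sp_tree T1 \<inter> set_sp_tree T2 = {}"
    using parallel.hyps by (simp add: set_sp_tree_eq_arcs)
  have outcomes: "outcomes u c (Parallel T1 T2) x =
    (\<Union>k \<in> {0..x}. {p + q | p q. p \<in> outcomes u c T1 k \<and> q \<in> outcomes u c T2 (x - k)})"
    by (rule outcomes_composition) (simp_all add: outcome_def disj)
  show ?case
    unfolding labels.simps outcomes parallel.IH plus_as_image
    by (rule minimal_points_Union_minimal_points) (simp add: add_mono)
next
  case (series G1 s v T1 G2 t T2)
  have disj: "set_sp_tree T1 \<inter> set_sp_tree T2 = {}"
    using series.hyps by (simp add: set_sp_tree_eq_arcs)
  have outcomes: "outcomes u c (Series T1 T2) x =
    (\<Union>k \<in> {0..x}. {(min (fst p) (fst q), min (snd p) (snd q)) | p q.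
       p \<in> outcomes u c T1 k \<and> q \<in> outcomes u c T2 (x - k)})"
    by (rule outcomes_composition) (simp_all add: outcome_def disj)
  show ?case
    unfolding labels.simps outcomes series.IH min_sum_def
    by (rule minimal_points_Union_minimal_points) (auto intro: min.coboundedI1 min.coboundedI2)
qed

lemma VAL_interdicted_graph:
  assumes "sp_decomposition G s t T"
  shows "VAL (interdicted_graph G \<gamma>) s t u = map_prod real real (outcome u T (interdicted_arcs G \<gamma>))"
  using assms
  by (simp add: VAL_def outcome_def max_flow_value_interdicted_graph sp_fin_digraph sp_max_flow_value)

text \<open>
  Strategies are 0-1 vectors, whereas outcomes are indexed by sets of arcs; the set of interdicted
  arcs translates one into the other.
\<close>

lemma interdicted_arcs_image_strategies:
  assumes "finite (arcs G)"
  shows "interdicted_arcs G ` strategies G c B = {S. S \<subseteq> arcs G \<and> sum c S \<le> B}"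
proof -
  have cost: "(\<Sum>a\<in>arcs G. c a * \<gamma> a) = sum c (interdicted_arcs G \<gamma>)"
    if "\<gamma> \<in> arcs G \<rightarrow>\<^sub>E {0, 1}" for \<gamma>
  proof -
    have "(\<Sum>a\<in>arcs G. c a * \<gamma> a) = (\<Sum>a\<in>arcs G. if \<gamma> a = 1 then c a else 0)"
      using that by (intro sum.cong) (auto simp: PiE_iff)
    then show ?thesis using assms by (simp add: interdicted_arcs_def sum.inter_filter)
  qed
  show ?thesis
  proof (intro equalityI subsetI)
    fix S assume "S \<in> interdicted_arcs G ` strategies G c B"
    then show "S \<in> {S. S \<subseteq> arcs G \<and> sum c S \<le> B}"
      using cost by (auto simp: strategies_def) (auto simp: interdicted_arcs_def)
  next
    fix S assume S: "S \<in> {S. S \<subseteq> arcs G \<and> sum c S \<le> B}"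
    define \<gamma> where "\<gamma> = (\<lambda>a\<in>arcs G. if a \<in> S then 1 else (0::nat))"
    have "\<gamma> \<in> arcs G \<rightarrow>\<^sub>E {0, 1}" "interdicted_arcs G \<gamma> = S"
      using S by (auto simp: \<gamma>_def interdicted_arcs_def)
    then show "S \<in> interdicted_arcs G ` strategies G c B"
      using S cost[of \<gamma>] by (auto simp: strategies_def intro!: image_eqI[of _ _ \<gamma>])
  qed
qed

lemma nondominated_points_eq_minimal_points:
  "nondominated_points G s t u c B =
    minimal_points ((\<lambda>\<gamma>. VAL (interdicted_graph G \<gamma>) s t u) ` strategies G c B)"
  by (auto simp: nondominated_points_def efficient_def minimal_points_def)

lemma minimal_points_map_real:
  "minimal_points (map_prod real real ` S) = map_prod real real ` minimal_points S"
proof -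
  have "map_prod real real y \<prec> map_prod real real z \<longleftrightarrow> y \<prec> z" for y z
    by (cases y; cases z) (auto simp: pt_dominates_def)
  then show ?thesis by (simp add: minimal_points_def Compr_image_eq)
qed

theorem theorem5:
  fixes G :: "('v, 'e) pre_digraph" and s t :: 'v
    and u :: "'e \<Rightarrow> nat \<times> nat" and c :: "'e \<Rightarrow> nat" and B :: nat
    and T :: "'e sp_tree"
  assumes "st_digraph G s t"
    and "sp_decomposition G s t T"
  shows "map_prod real real ` labels u c T B = nondominated_points G s t u c B"
proof -
  interpret st_digraph G s t by fact
  have "(\<lambda>\<gamma>. VAL (interdicted_graph G \<gamma>) s t u) ` strategies G c B
      = (\<lambda>S. map_prod real real (outcome u T S)) ` interdicted_arcs G ` strategies G c B"
    by (simp add: VAL_interdicted_graph[OF assms(2)] image_image)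
  also have "\<dots> = map_prod real real ` outcomes u c T B"
    by (simp add: interdicted_arcs_image_strategies outcomes_def set_sp_tree_eq_arcs[OF assms(2)]
        setcompr_eq_image image_image)
  finally show ?thesis
    by (simp add: nondominated_points_eq_minimal_points minimal_points_map_real
        labels_eq_minimal_outcomes[OF assms(2)])
qed

end
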